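(* Let $A\in\mathbb{R}^{n\times n}$, $B\in\mathbb{R}^{n\times m}$, $Q=Q^{T}\in\mathbb{R}^{n\times n}$, $S\in\mathbb{R}^{n\times m}$, $R=R^{T}\in\mathbb{R}^{m\times m}$ with $\begin{bmatrix}Q&S\\S^{T}&R\end{bmatrix}\ge0$. Let $X_1=X_1^{T}$ and $X_2=X_2^{T}$ be two solutions of CGDARE($\Sigma$). Then $\ker R_{X_1}=\ker R_{X_2}$.
   Context: $M^{\dagger}$ denotes the Moore-Penrose pseudo-inverse of $M$. With $\Sigma=(A,B;Q,R,S)$, $X=X^{T}\in\mathbb{R}^{n\times n}$ is a solution of CGDARE($\Sigma$) if $X=A^{T}XA-(A^{T}XB+S)(R+B^{T}XB)^{\dagger}(B^{T}XA+S^{T})+Q$ and $\ker(R+B^{T}XB)\subseteq\ker(A^{T}XB+S)$. For $X=X^{T}$, $R_X=R+B^{T}XB$. *)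

theory Defs
  imports "HOL-Analysis.Analysis"
begin

text \<open>A matrix with rows indexed by \<open>'p\<close> and columns by \<open>'q\<close> has type \<open>real ^ 'q ^ 'p\<close>.\<close>

definition mat_ker :: "real ^ 'q ^ 'p \<Rightarrow> (real ^ 'q) set" where
  "mat_ker M = {v. M *v v = 0}"

text \<open>The four Penrose conditions; they determine \<open>N\<close> uniquely and are always satisfiable, so the
  definite description in \<open>pinv\<close> is proper (lemma \<open>is_pinv_pinv\<close>).\<close>

definition is_pinv :: "real ^ 'q ^ 'p \<Rightarrow> real ^ 'p ^ 'q \<Rightarrow> bool" where
  "is_pinv M N \<longleftrightarrow>
     M ** N ** M = M \<and> N ** M ** N = N \<and>
     transpose (M ** N) = M ** N \<and> transpose (N ** M) = N ** M"

definition pinv :: "real ^ 'q ^ 'p \<Rightarrow> real ^ 'p ^ 'q" where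
  "pinv M = (THE N. is_pinv M N)"

lemma is_pinv_unique:
  fixes M :: "real ^ 'q ^ 'p"
  assumes N: "is_pinv M N" and K: "is_pinv M K"
  shows "N = K"
proof -
  have MN: "M ** N = M ** K"
  proof -
    have "M ** N = transpose (M ** N)" using N by (simp add: is_pinv_def)
    also have "\<dots> = transpose ((M ** K) ** (M ** N))"
      using K by (simp add: is_pinv_def matrix_mul_assoc)
    also have "\<dots> = (M ** N) ** (M ** K)"
      using N K by (simp add: is_pinv_def matrix_transpose_mul)
    also have "\<dots> = M ** K" using N by (simp add: is_pinv_def matrix_mul_assoc)
    finally show ?thesis .
  qed
  have NM: "N ** M = K ** M"
  proof -
    have "N ** M = transpose (N ** M)" using N by (simp add: is_pinv_def)
    also have "\<dots> = transpose ((N ** M) ** (K ** M))"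
      using K by (metis is_pinv_def matrix_mul_assoc)
    also have "\<dots> = (K ** M) ** (N ** M)"
      using N K by (simp add: is_pinv_def matrix_transpose_mul)
    also have "\<dots> = K ** M" using N by (metis is_pinv_def matrix_mul_assoc)
    finally show ?thesis .
  qed
  have "N = N ** M ** N" using N by (simp add: is_pinv_def)
  also have "\<dots> = K ** M ** N" by (simp add: NM)
  also have "\<dots> = K ** M ** K" by (metis MN matrix_mul_assoc)
  also have "\<dots> = K" using K by (simp add: is_pinv_def)
  finally show ?thesis .
qed

lemma is_pinv_exists:
  fixes M :: "real ^ 'q ^ 'p"
  shows "\<exists>N. is_pinv M N"
proof -
  let ?R = "range ((*v) M)"
  let ?W = "range ((*v) (transpose M))"
  have subR: "subspace ?R" and subW: "subspace ?W"
    by (rule linear_subspace_image[OF matrix_vector_mul_linear subspace_UNIV])+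
  then have spR: "span ?R = ?R" and spW: "span ?W = ?W"
    by (simp_all only: span_eq_iff)
  have WM: "(M *v x) = 0" if "\<And>w. w \<in> ?W \<Longrightarrow> orthogonal x w" for x
  proof -
    have "(M *v x) \<bullet> (M *v x) = x \<bullet> (transpose M *v (M *v x))"
      by (metis dot_lmul_matrix inner_commute matrix_vector_mul_assoc transpose_matrix_vector)
    also have "\<dots> = 0" using that by (auto simp: orthogonal_def)
    finally show ?thesis by simp
  qed
  have ex: "\<exists>x. x \<in> ?W \<and> (\<forall>z. (y - M *v x) \<bullet> (M *v z) = 0)" for y
  proof -
    obtain a b where a: "a \<in> span ?R" and b: "\<And>w. w \<in> span ?R \<Longrightarrow> orthogonal b w" and y: "y = a + b"
      using orthogonal_subspace_decomp_exists by blast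
    from a obtain u where u: "a = M *v u" unfolding spR by blast
    obtain c d where c: "c \<in> span ?W" and d: "\<And>w. w \<in> span ?W \<Longrightarrow> orthogonal d w" and ucd: "u = c + d"
      using orthogonal_subspace_decomp_exists by blast
    have "M *v d = 0" using d by (intro WM) (auto intro: span_base)
    then have "a = M *v c" using u ucd by (simp add: matrix_vector_right_distrib)
    moreover have "c \<in> ?W" using c unfolding spW .
    ultimately show ?thesis
      using b y by (intro exI[of _ c]) (auto simp: orthogonal_def intro: span_base)
  qed
  have uniq: "x = x'" if h: "x \<in> ?W" "\<forall>z. (y - M *v x) \<bullet> (M *v z) = 0"
     "x' \<in> ?W" "\<forall>z. (y - M *v x') \<bullet> (M *v z) = 0" for x x' y
  proof -
    have "(M *v (x - x')) \<bullet> (M *v (x - x')) = 0"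
      using h(2)[rule_format, of "x - x'"] h(4)[rule_format, of "x - x'"]
      by (simp add: matrix_vector_mult_diff_distrib inner_diff_left)
    then have z: "M *v (x - x') = 0" by simp
    obtain t where t: "x - x' = transpose M *v t"
      using subspace_diff[OF subW h(1) h(3)] by auto
    have "(x - x') \<bullet> (x - x') = (M *v (x - x')) \<bullet> t"
      by (metis t dot_lmul_matrix inner_commute transpose_matrix_vector)
    then show ?thesis using z by simp
  qed
  define g where "g y = (SOME x. x \<in> ?W \<and> (\<forall>z. (y - M *v x) \<bullet> (M *v z) = 0))" for y
  have g: "g y \<in> ?W" "\<forall>z. (y - M *v g y) \<bullet> (M *v z) = 0" for y
    using someI_ex[OF ex[of y]] unfolding g_def by blast+
  have gI: "g y = x" if "x \<in> ?W" "\<forall>z. (y - M *v x) \<bullet> (M *v z) = 0" for x y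
    using uniq[OF g that] .
  have lin: "linear g"
  proof (rule linearI)
    fix x y show "g (x + y) = g x + g y"
    proof (rule gI)
      show "g x + g y \<in> ?W" using g(1) by (intro subspace_add[OF subW])
      show "\<forall>z. (x + y - M *v (g x + g y)) \<bullet> (M *v z) = 0"
        using g(2)[of x] g(2)[of y] by (simp add: matrix_vector_right_distrib inner_diff_left inner_add_left)
    qed
  next
    fix c x show "g (c *\<^sub>R x) = c *\<^sub>R g x"
    proof (rule gI)
      show "c *\<^sub>R g x \<in> ?W" using g(1) by (intro subspace_scale[OF subW])
      show "\<forall>z. (c *\<^sub>R x - M *v (c *\<^sub>R g x)) \<bullet> (M *v z) = 0"
        using g(2)[of x] by (simp add: matrix_vector_mult_scaleR inner_diff_left)
    qed
  qed
  define N where "N = matrix g"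
  have N: "N *v y = g y" for y unfolding N_def using lin by (simp add: matrix_works)
  have gM: "M *v g (M *v x) = M *v x" for x
  proof -
    have "(M *v x - M *v g (M *v x)) \<bullet> (M *v (x - g (M *v x))) = 0" using g(2) by blast
    then show ?thesis by (simp add: matrix_vector_mult_diff_distrib)
  qed
  have gMg: "g (M *v g y) = g y" for y using g(1) by (intro gI) auto
  have symI: "transpose K = K" if "\<And>x y. (K *v x) \<bullet> y = x \<bullet> (K *v y)" for K :: "real ^ 'k ^ 'k"
  proof -
    have "x \<bullet> (transpose K *v y) = x \<bullet> (K *v y)" for x y
      by (metis that dot_lmul_matrix inner_commute transpose_matrix_vector)
    then show ?thesis by (metis matrix_eq vector_eq_ldot)
  qed
  have "transpose (M ** N) = M ** N"
  proof (rule symI)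
    fix x y
    have "y \<bullet> (M *v g x) = (M *v g y) \<bullet> (M *v g x)"
      using g(2)[of y, rule_format, of "g x"] by (simp add: inner_diff_left)
    then have "(M *v g x) \<bullet> y = (M *v g x) \<bullet> (M *v g y)"
      by (simp only: inner_commute)
    also have "\<dots> = x \<bullet> (M *v g y)"
      using g(2)[of x, rule_format, of "g y"] by (simp add: inner_diff_left)
    finally show "(M ** N *v x) \<bullet> y = x \<bullet> (M ** N *v y)"
      by (simp add: N flip: matrix_vector_mul_assoc)
  qed
  moreover have "transpose (N ** M) = N ** M"
  proof (rule symI)
    have *: "w \<bullet> (g (M *v x) - x) = 0" if w: "w \<in> ?W" for w x
    proof -
      from w obtain t where t: "w = transpose M *v t" by auto
      have "w \<bullet> (g (M *v x) - x) = t \<bullet> (M *v (g (M *v x) - x))"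
        by (metis t dot_lmul_matrix transpose_matrix_vector)
      also have "\<dots> = 0" using gM by (simp add: matrix_vector_mult_diff_distrib)
      finally show ?thesis .
    qed
    fix x y
    show "(N ** M *v x) \<bullet> y = x \<bullet> (N ** M *v y)"
      using *[OF g(1)[of "M *v x"], of y] *[OF g(1)[of "M *v y"], of x]
      by (simp add: N inner_diff_right inner_commute flip: matrix_vector_mul_assoc)
  qed
  moreover have "M ** N ** M = M"
    by (simp add: matrix_eq N gM flip: matrix_vector_mul_assoc)
  moreover have "N ** M ** N = N"
    by (simp add: matrix_eq N gMg flip: matrix_vector_mul_assoc)
  ultimately show ?thesis unfolding is_pinv_def by blast
qed

lemma is_pinv_pinv: "is_pinv M (pinv M)"
  unfolding pinv_def by (rule theI') (blast intro: is_pinv_exists is_pinv_unique)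

definition block_matrix ::
  "real ^ 'n ^ 'n \<Rightarrow> real ^ 'm ^ 'n \<Rightarrow> real ^ 'n ^ 'm \<Rightarrow> real ^ 'm ^ 'm
    \<Rightarrow> real ^ ('n + 'm) ^ ('n + 'm)" where
  "block_matrix M11 M12 M21 M22 =
     (\<chi> i j. case i of
        Inl i \<Rightarrow> (case j of Inl j \<Rightarrow> M11 $ i $ j | Inr j \<Rightarrow> M12 $ i $ j)
      | Inr i \<Rightarrow> (case j of Inl j \<Rightarrow> M21 $ i $ j | Inr j \<Rightarrow> M22 $ i $ j))"

definition psd :: "real ^ 'k ^ 'k \<Rightarrow> bool" where
  "psd M \<longleftrightarrow> transpose M = M \<and> (\<forall>v. 0 \<le> v \<bullet> (M *v v))"

definition R_of :: "real ^ 'm ^ 'n \<Rightarrow> real ^ 'm ^ 'm \<Rightarrow> real ^ 'n ^ 'n \<Rightarrow> real ^ 'm ^ 'm" where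
  "R_of B R X = R + transpose B ** X ** B"

text \<open>\<open>CGDARE_solution A B Q R S X\<close>: \<open>X\<close> solves the constrained generalized discrete algebraic
  Riccati equation for \<open>\<Sigma> = (A, B; Q, R, S)\<close>.\<close>

definition CGDARE_solution ::
  "real ^ 'n ^ 'n \<Rightarrow> real ^ 'm ^ 'n \<Rightarrow> real ^ 'n ^ 'n \<Rightarrow> real ^ 'm ^ 'm \<Rightarrow> real ^ 'm ^ 'n
    \<Rightarrow> real ^ 'n ^ 'n \<Rightarrow> bool" where
  "CGDARE_solution A B Q R S X \<longleftrightarrow>
     transpose X = X \<and>
     X = transpose A ** X ** A
         - (transpose A ** X ** B + S) ** pinv (R + transpose B ** X ** B)
             ** (transpose B ** X ** A + transpose S)
         + Q \<and>
     mat_ker (R + transpose B ** X ** B) \<subseteq> mat_ker (transpose A ** X ** B + S)"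

end

theory Submission
  imports Defs
begin

text \<open>For a solution \<open>X\<close> of the CGDARE there is a feedback \<open>F\<close> such that along every trajectory
  \<open>x\<^sub>k\<^sub>+\<^sub>1 = A x\<^sub>k + B u\<^sub>k\<close> the running cost equals
  \<open>x\<^sub>k \<bullet> X x\<^sub>k - x\<^sub>k\<^sub>+\<^sub>1 \<bullet> X x\<^sub>k\<^sub>+\<^sub>1 + w\<^sub>k \<bullet> R\<^sub>X w\<^sub>k\<close> with \<open>w\<^sub>k = u\<^sub>k - F x\<^sub>k\<close>. Hence, over a trajectory
  from \<open>0\<close> back to \<open>0\<close>, the total cost is \<open>\<Sum> w\<^sub>k \<bullet> R\<^sub>X w\<^sub>k\<close>.
  For each \<open>w\<close> there is such a trajectory with \<open>w\<^sub>k = c\<^sub>k w\<close> and \<open>c\<^sub>0 = 1\<close>: take the coefficients of a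
  polynomial in \<open>A + B F\<close> that annihilates \<open>B w\<close>. Nonnegativity of the cost then gives
  \<open>R\<^sub>X \<ge> 0\<close>. If \<open>w\<close> lies in the kernel for \<open>X\<^sub>1\<close>, the trajectory built from \<open>F\<^sub>1\<close> has cost zero;
  evaluating that cost with \<open>X\<^sub>2\<close>, whose first term is \<open>w \<bullet> R\<^sub>X\<^sub>2 w\<close>, puts \<open>w\<close> in the kernel for \<open>X\<^sub>2\<close>.\<close>

section \<open>Running cost and semidefinite forms\<close>

definition stage_cost ::
  "real ^ 'n ^ 'n \<Rightarrow> real ^ 'm ^ 'm \<Rightarrow> real ^ 'm ^ 'n \<Rightarrow> real ^ 'n \<Rightarrow> real ^ 'm \<Rightarrow> real" where
  "stage_cost Q R S x u = x \<bullet> (Q *v x) + 2 * (x \<bullet> (S *v u)) + u \<bullet> (R *v u)"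

lemma inner_transpose_mult:
  fixes M :: "real ^ 'q ^ 'p"
  shows "x \<bullet> (transpose M *v y) = (M *v x) \<bullet> y"
  by (metis dot_lmul_matrix inner_commute transpose_matrix_vector)

lemma inner_symmetric_mult:
  fixes M :: "real ^ 'q ^ 'q"
  assumes "transpose M = M"
  shows "(M *v x) \<bullet> y = x \<bullet> (M *v y)"
  using inner_transpose_mult[of x M y] assms by simp

lemma block_matrix_quadratic:
  fixes x :: "real ^ 'n" and u :: "real ^ 'm"
  shows "\<exists>v. v \<bullet> (block_matrix Q S (transpose S) R *v v) = stage_cost Q R S x u"
proof
  let ?v = "(\<chi> i. case i of Inl i \<Rightarrow> x $ i | Inr i \<Rightarrow> u $ i) :: real ^ ('n + 'm)"
  have S: "u \<bullet> (transpose S *v x) = x \<bullet> (S *v u)"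
    by (subst inner_transpose_mult) (rule inner_commute)
  have *: "(\<Sum>k\<in>UNIV. f k) = (\<Sum>i\<in>UNIV. f (Inl i)) + (\<Sum>i\<in>UNIV. f (Inr i))"
    for f :: "'n + 'm \<Rightarrow> real"
    by (simp add: UNIV_Plus_UNIV[symmetric] sum.Plus del: UNIV_Plus_UNIV)
  have "?v \<bullet> (block_matrix Q S (transpose S) R *v ?v)
      = x \<bullet> (Q *v x) + x \<bullet> (S *v u) + u \<bullet> (transpose S *v x) + u \<bullet> (R *v u)"
    by (simp add: inner_vec_def matrix_vector_mult_def block_matrix_def * distrib_left sum.distrib)
  then show "?v \<bullet> (block_matrix Q S (transpose S) R *v ?v) = stage_cost Q R S x u"
    by (simp only: S stage_cost_def)
qed

lemma stage_cost_nonneg: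
  assumes "psd (block_matrix Q S (transpose S) R)"
  shows "0 \<le> stage_cost Q R S x u"
  using assms block_matrix_quadratic[of Q S R x u] by (metis psd_def)

text \<open>If \<open>M *v v\<close> were nonzero, a small step from \<open>v\<close> against
  \<open>M *v v\<close> would make the quadratic form negative.\<close>

lemma psd_isotropic_imp_ker:
  assumes M: "psd M" and v: "v \<bullet> (M *v v) = 0"
  shows "v \<in> mat_ker M"
proof (rule ccontr)
  assume "v \<notin> mat_ker M"
  define y where "y = M *v v"
  define a where "a = y \<bullet> y"
  define b where "b = y \<bullet> (M *v y)"
  have a: "a > 0" using \<open>v \<notin> mat_ker M\<close> by (simp add: a_def y_def mat_ker_def)
  have b: "b \<ge> 0" using M by (simp add: b_def psd_def)
  have vMy: "v \<bullet> (M *v y) = a"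
    using inner_symmetric_mult[of M v y] M by (simp add: a_def psd_def y_def)
  \<comment> \<open>The \<open>+ 1\<close> covers \<open>b = 0\<close> and gives
    \<open>t * b > - a\<close>, so the linear term in \<open>t\<close> dominates.\<close>
  define t where "t = - a / (b + 1)"
  have "0 \<le> (v + t *\<^sub>R y) \<bullet> (M *v (v + t *\<^sub>R y))"
    using M by (simp add: psd_def)
  also have "\<dots> = t * (2 * a + t * b)"
    using v vMy
    by (simp add: matrix_vector_right_distrib matrix_vector_mult_scaleR inner_add_left
        inner_add_right a_def b_def algebra_simps flip: y_def)
  also have "\<dots> < 0"
  proof (rule mult_neg_pos)
    show "t < 0" using a b by (simp add: t_def)
    have "0 \<le> a * b" using a b by simp
    then have "a * b < (2 * a) * (b + 1)" using a by (simp add: algebra_simps)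
    then show "0 < 2 * a + t * b"
      using b by (simp add: t_def field_simps)
  qed
  finally show False by simp
qed

section \<open>Trajectories from the origin back to the origin\<close>

lemma span_image_lessThan:
  fixes f :: "nat \<Rightarrow> 'a :: real_vector"
  assumes "y \<in> span (f ` {..<N})"
  shows "\<exists>a. y = (\<Sum>i<N. a i *\<^sub>R f i)"
  using assms
proof (induction N arbitrary: y)
  case (Suc N)
  then obtain k where "y - k *\<^sub>R f N \<in> span (f ` {..<N})"
    by (auto simp: lessThan_Suc span_breakdown_eq)
  then obtain a where "y - k *\<^sub>R f N = (\<Sum>i<N. a i *\<^sub>R f i)"
    using Suc.IH by blast
  then have "y = (\<Sum>i<Suc N. (a(N := k)) i *\<^sub>R f i)"
    by (simp add: algebra_simps)
  then show ?case by blast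
qed simp

text \<open>Otherwise every new term raises the dimension of the span by one, eventually beyond
  \<open>DIM('a)\<close>.\<close>

lemma sequence_meets_span_of_predecessors:
  fixes f :: "nat \<Rightarrow> 'a :: euclidean_space"
  shows "\<exists>N. f N \<in> span (f ` {..<N})"
proof (rule ccontr)
  assume "\<nexists>N. f N \<in> span (f ` {..<N})"
  then have "dim (f ` {..<N}) = N" for N
    by (induction N) (auto simp: lessThan_Suc dim_insert)
  from this[of "Suc DIM('a)"] dim_subset_UNIV[of "f ` {..<Suc DIM('a)}"] show False by simp
qed

lemma scalar_input_loop:
  fixes M :: "real ^ 'n ^ 'n" and b :: "real ^ 'n"
  obtains x :: "nat \<Rightarrow> real ^ 'n" and c :: "nat \<Rightarrow> real" and N
  where "x 0 = 0" "c 0 = 1" "x (Suc N) = 0" "\<And>k. x (Suc k) = M *v x k + c k *\<^sub>R b"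
proof -
  define f where "f i = (((*v) M) ^^ i) b" for i
  obtain N where "f N \<in> span (f ` {..<N})"
    using sequence_meets_span_of_predecessors by blast
  then obtain a where a: "f N = (\<Sum>i<N. a i *\<^sub>R f i)"
    using span_image_lessThan by blast
  \<comment> \<open>The input applied first meets the highest power of \<open>M\<close>, so the
    annihilating polynomial is read from its leading coefficient down. Values at
    \<open>k > N\<close> do not affect \<open>x (Suc N)\<close>.\<close>
  define c where "c k = (if k = 0 then 1 else - a (N - k))" for k
  define x where "x = rec_nat 0 (\<lambda>k y. M *v y + c k *\<^sub>R b)"
  have x: "x 0 = 0" "x (Suc k) = M *v x k + c k *\<^sub>R b" for k
    by (simp_all add: x_def)
  have fS: "M *v f i = f (Suc i)" for i by (simp add: f_def)
  have f0: "f 0 = b" by (simp add: f_def)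
  have expl: "x k = (\<Sum>i<k. c (k - Suc i) *\<^sub>R f i)" for k
  proof (induction k)
    case (Suc k)
    have "x (Suc k) = (\<Sum>i<k. c (k - Suc i) *\<^sub>R f (Suc i)) + c k *\<^sub>R f 0"
      by (simp add: x Suc matrix_vector_right_distrib matrix_vector_mult_scaleR fS f0
          linear_sum[OF matrix_vector_mul_linear])
    then show ?case by (simp add: sum.lessThan_Suc_shift algebra_simps del: sum.lessThan_Suc)
  qed (simp add: x)
  have "x (Suc N) = (\<Sum>i<N. c (N - i) *\<^sub>R f i) + f N"
    by (simp add: expl c_def)
  also have "(\<Sum>i<N. c (N - i) *\<^sub>R f i) = (\<Sum>i<N. - (a i *\<^sub>R f i))"
    by (intro sum.cong) (auto simp: c_def)
  finally have "x (Suc N) = 0" using a by (simp add: sum_negf)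
  then show ?thesis using that[of x c N] x by (simp add: c_def)
qed

section \<open>Completion of squares for a Riccati solution\<close>

lemma transpose_matrix_add: "transpose (M + N) = transpose M + transpose N"
  by (simp add: transpose_def vec_eq_iff)

lemma R_of_symmetric:
  assumes "transpose R = R" "transpose X = X"
  shows "transpose (R_of B R X) = R_of B R X"
  using assms by (simp add: R_of_def transpose_matrix_add matrix_transpose_mul matrix_mul_assoc)

text \<open>The witness is \<open>F = - (R\<^sub>X\<^sup>\<dagger>)\<^sup>T (B\<^sup>T X A + S\<^sup>T)\<close>; with the transposed pseudo-inverse,
  \<open>R\<^sub>X F = - (B\<^sup>T X A + S\<^sup>T)\<close> follows from the kernel condition without knowing that \<open>R\<^sub>X\<^sup>\<dagger>\<close> is symmetric.\<close>

lemma CGDARE_completion_of_squares: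
  fixes A :: "real ^ 'n ^ 'n" and B :: "real ^ 'm ^ 'n"
  assumes R: "transpose R = R" and sol: "CGDARE_solution A B Q R S X"
  obtains F where "\<And>x u. stage_cost Q R S x u + (A *v x + B *v u) \<bullet> (X *v (A *v x + B *v u))
      = x \<bullet> (X *v x) + (u - F *v x) \<bullet> (R_of B R X *v (u - F *v x))"
proof -
  define G where "G = transpose A ** X ** B + S"
  define K where "K = R_of B R X"
  define P where "P = pinv K"
  have X: "transpose X = X" and ker: "mat_ker K \<subseteq> mat_ker G"
    and eq: "X = transpose A ** X ** A - G ** P ** (transpose B ** X ** A + transpose S) + Q"
    using sol by (simp_all add: CGDARE_solution_def G_def K_def P_def R_of_def)
  have GT: "transpose G = transpose B ** X ** A + transpose S"
    using X by (simp add: G_def transpose_matrix_add matrix_transpose_mul matrix_mul_assoc)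
  have K: "transpose K = K" using R X by (simp add: K_def R_of_symmetric)
  have KPK: "K ** P ** K = K" using is_pinv_pinv[of K] by (simp add: P_def is_pinv_def)
  \<comment> \<open>\<open>K\<close> annihilates \<open>v - P *v (K *v v)\<close>, hence so does
    \<open>G\<close> by the kernel condition.\<close>
  have GPK: "G *v (P *v (K *v v)) = G *v v" for v
  proof -
    have "K *v (P *v (K *v v)) = K *v v"
      by (metis KPK matrix_vector_mul_assoc)
    then have "v - P *v (K *v v) \<in> mat_ker K"
      by (simp add: mat_ker_def matrix_vector_mult_diff_distrib)
    then have "v - P *v (K *v v) \<in> mat_ker G" using ker by blast
    then show ?thesis by (simp add: mat_ker_def matrix_vector_mult_diff_distrib)
  qed
  define F where "F = - (transpose P ** transpose G)"
  have neg: "(- M) *v v = - (M *v v)" for M :: "real ^ 'n ^ 'm" and v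
    by (simp add: vec_eq_iff matrix_vector_mult_def sum_negf)
  have F: "F *v x = - (transpose P *v (transpose G *v x))" for x
    by (simp add: F_def neg matrix_vector_mul_assoc del: transpose_matrix_vector)
  have KF: "(F *v x) \<bullet> (K *v v) = - (x \<bullet> (G *v v))" for x v
    by (simp add: F del: transpose_matrix_vector) (metis GPK inner_transpose_mult inner_commute)
  have Xx: "x \<bullet> (X *v x) = (A *v x) \<bullet> (X *v (A *v x)) + x \<bullet> (G *v (F *v x)) + x \<bullet> (Q *v x)" for x
  proof -
    have "X *v x = transpose A *v (X *v (A *v x)) - G *v (P *v (transpose G *v x)) + Q *v x"
      by (subst eq[folded GT]) (simp add: matrix_vector_mult_add_rdistrib
          matrix_vector_mult_diff_rdistrib matrix_vector_mul_assoc matrix_mul_assoc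
          del: transpose_matrix_vector)
    \<comment> \<open>A quadratic form agrees with that of its transpose, so \<open>P\<close> may be
      exchanged for the \<open>transpose P\<close> in \<open>F\<close>.\<close>
    moreover have "x \<bullet> (G *v (P *v (transpose G *v x))) = - (x \<bullet> (G *v (F *v x)))"
      by (simp add: F linear_neg[OF matrix_vector_mul_linear] del: transpose_matrix_vector)
        (metis inner_transpose_mult inner_commute)
    ultimately show ?thesis by (simp add: inner_add_right inner_diff_right inner_transpose_mult
          del: transpose_matrix_vector)
  qed
  show ?thesis
  proof
    fix x u
    have Kuu: "u \<bullet> (K *v u) = u \<bullet> (R *v u) + (B *v u) \<bullet> (X *v (B *v u))"
      by (simp add: K_def R_of_def matrix_vector_mult_add_rdistrib inner_add_right
          inner_transpose_mult del: transpose_matrix_vector flip: matrix_vector_mul_assoc)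
    have Gu: "x \<bullet> (G *v u) = (A *v x) \<bullet> (X *v (B *v u)) + x \<bullet> (S *v u)"
      by (simp add: G_def matrix_vector_mult_add_rdistrib inner_add_right
          inner_transpose_mult del: transpose_matrix_vector flip: matrix_vector_mul_assoc)
    have sX: "(B *v u) \<bullet> (X *v (A *v x)) = (A *v x) \<bullet> (X *v (B *v u))"
      using inner_symmetric_mult[OF X, of "B *v u" "A *v x"] by (simp add: inner_commute)
    have sK: "u \<bullet> (K *v (F *v x)) = (F *v x) \<bullet> (K *v u)"
      using inner_symmetric_mult[OF K, of u "F *v x"] by (simp add: inner_commute)
    show "stage_cost Q R S x u + (A *v x + B *v u) \<bullet> (X *v (A *v x + B *v u))
      = x \<bullet> (X *v x) + (u - F *v x) \<bullet> (R_of B R X *v (u - F *v x))"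
      unfolding K_def[symmetric] stage_cost_def
      by (simp add: matrix_vector_right_distrib matrix_vector_mult_diff_distrib inner_add_left
          inner_add_right inner_diff_left inner_diff_right sX sK KF Kuu Gu Xx[of x])
  qed
qed

section \<open>Comparing costs along closed trajectories\<close>

text \<open>The terms in \<open>X\<close> telescope and vanish at both ends. The left side does not
  mention \<open>X\<close>, which is what links two solutions.\<close>

lemma stage_cost_loop:
  assumes sq: "\<And>x u. stage_cost Q R S x u + (A *v x + B *v u) \<bullet> (X *v (A *v x + B *v u))
      = x \<bullet> (X *v x) + (u - F *v x) \<bullet> (K *v (u - F *v x))"
    and x: "\<And>k. x (Suc k) = A *v x k + B *v u k" "x 0 = 0" "x (Suc N) = 0"
  shows "(\<Sum>k\<le>N. stage_cost Q R S (x k) (u k))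
    = (\<Sum>k\<le>N. (u k - F *v x k) \<bullet> (K *v (u k - F *v x k)))"
proof -
  have "(\<Sum>k\<le>n. stage_cost Q R S (x k) (u k)) + x (Suc n) \<bullet> (X *v x (Suc n))
    = (\<Sum>k\<le>n. (u k - F *v x k) \<bullet> (K *v (u k - F *v x k)))" for n
  proof (induction n)
    case 0 then show ?case using sq[of "x 0" "u 0"] x by simp
  next
    case (Suc n)
    then show ?case using sq[of "x (Suc n)" "u (Suc n)"] x(1)[of "Suc n"] by simp
  qed
  from this[of N] show ?thesis using x by simp
qed

text \<open>Under the feedback \<open>F\<close>, the system has matrix \<open>A + B ** F\<close> and
  a scalar input along \<open>B *v w\<close>.\<close>

lemma feedback_loop:
  fixes A :: "real ^ 'n ^ 'n" and B :: "real ^ 'm ^ 'n"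
  obtains x u c N
  where "x 0 = 0" "x (Suc N) = 0" "\<And>k. x (Suc k) = A *v x k + B *v u k"
    "c 0 = (1 :: real)" "\<And>k. u k = F *v x k + c k *\<^sub>R w"
proof -
  obtain x c N where x: "x 0 = 0" "c 0 = (1 :: real)" "x (Suc N) = 0"
      "\<And>k. x (Suc k) = (A + B ** F) *v x k + c k *\<^sub>R (B *v w)"
    using scalar_input_loop[where M = "A + B ** F" and b = "B *v w"] by blast
  show ?thesis
  proof (rule that[of x N "\<lambda>k. F *v x k + c k *\<^sub>R w" c])
    show "x (Suc k) = A *v x k + B *v (F *v x k + c k *\<^sub>R w)" for k
      unfolding x(4) by (simp add: matrix_vector_mult_add_rdistrib matrix_vector_right_distrib
        matrix_vector_mult_scaleR matrix_vector_mul_assoc)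
  qed (rule x refl)+
qed

lemma psd_R_of_CGDARE:
  assumes R: "transpose R = R" and psd: "psd (block_matrix Q S (transpose S) R)"
    and sol: "CGDARE_solution A B Q R S X"
  shows "psd (R_of B R X)"
  unfolding psd_def
proof (intro conjI allI)
  show "transpose (R_of B R X) = R_of B R X"
    using R sol by (simp add: R_of_symmetric CGDARE_solution_def)
  fix w
  obtain F where F: "\<And>x u. stage_cost Q R S x u + (A *v x + B *v u) \<bullet> (X *v (A *v x + B *v u))
      = x \<bullet> (X *v x) + (u - F *v x) \<bullet> (R_of B R X *v (u - F *v x))"
    using CGDARE_completion_of_squares[OF R sol] by blast
  obtain x N u c where x: "x 0 = 0" "x (Suc N) = 0" "\<And>k. x (Suc k) = A *v x k + B *v u k"
    and c: "c 0 = (1 :: real)" and u: "\<And>k. u k = F *v x k + c k *\<^sub>R w"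
    by (rule feedback_loop[where A = A and B = B and F = F and w = w]) (rule that; assumption)
  have "0 \<le> (\<Sum>k\<le>N. stage_cost Q R S (x k) (u k))"
    by (intro sum_nonneg stage_cost_nonneg psd)
  also have "\<dots> = (\<Sum>k\<le>N. (c k)\<^sup>2) * (w \<bullet> (R_of B R X *v w))"
    unfolding stage_cost_loop[OF F x(3,1,2)]
    by (simp add: u matrix_vector_mult_scaleR sum_distrib_right power2_eq_square mult.assoc)
  finally have "0 \<le> (\<Sum>k\<le>N. (c k)\<^sup>2) * (w \<bullet> (R_of B R X *v w))" .
  \<comment> \<open>The normalization \<open>c 0 = 1\<close> keeps the factor from
    vanishing.\<close>
  moreover have "(\<Sum>k\<le>N. (c k)\<^sup>2) > 0"
    using c by (intro sum_pos2[of _ 0]) auto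
  ultimately show "0 \<le> w \<bullet> (R_of B R X *v w)"
    by (simp add: zero_le_mult_iff)
qed

lemma mat_ker_R_of_CGDARE_subset:
  assumes R: "transpose R = R" and psd: "psd (block_matrix Q S (transpose S) R)"
    and sol1: "CGDARE_solution A B Q R S X1" and sol2: "CGDARE_solution A B Q R S X2"
  shows "mat_ker (R_of B R X1) \<subseteq> mat_ker (R_of B R X2)"
proof
  fix w assume w: "w \<in> mat_ker (R_of B R X1)"
  let ?K = "R_of B R X2"
  obtain F where F: "\<And>x u. stage_cost Q R S x u + (A *v x + B *v u) \<bullet> (X1 *v (A *v x + B *v u))
      = x \<bullet> (X1 *v x) + (u - F *v x) \<bullet> (R_of B R X1 *v (u - F *v x))"
    using CGDARE_completion_of_squares[OF R sol1] by blast
  obtain F' where F': "\<And>x u. stage_cost Q R S x u + (A *v x + B *v u) \<bullet> (X2 *v (A *v x + B *v u))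
      = x \<bullet> (X2 *v x) + (u - F' *v x) \<bullet> (?K *v (u - F' *v x))"
    using CGDARE_completion_of_squares[OF R sol2] by blast
  obtain x N u c where x: "x 0 = 0" "x (Suc N) = 0" "\<And>k. x (Suc k) = A *v x k + B *v u k"
    and c: "c 0 = (1 :: real)" and u: "\<And>k. u k = F *v x k + c k *\<^sub>R w"
    by (rule feedback_loop[where A = A and B = B and F = F and w = w]) (rule that; assumption)
  have K: "psd ?K" using psd_R_of_CGDARE[OF R psd sol2] .
  have "(\<Sum>k\<le>N. (u k - F' *v x k) \<bullet> (?K *v (u k - F' *v x k)))
      = (\<Sum>k\<le>N. (u k - F *v x k) \<bullet> (R_of B R X1 *v (u k - F *v x k)))"
    using stage_cost_loop[OF F x(3,1,2)] stage_cost_loop[OF F' x(3,1,2)] by simp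
  also have "\<dots> = 0"
    using w by (simp add: u mat_ker_def matrix_vector_mult_scaleR)
  finally have "\<forall>k\<in>{..N}. (u k - F' *v x k) \<bullet> (?K *v (u k - F' *v x k)) = 0"
    using K by (subst (asm) sum_nonneg_eq_0_iff) (auto simp: psd_def)
  \<comment> \<open>At time 0 the state is zero, so neither feedback acts and
    \<open>u 0 = w\<close>.\<close>
  then have "(u 0 - F' *v x 0) \<bullet> (?K *v (u 0 - F' *v x 0)) = 0" by blast
  then have "w \<bullet> (?K *v w) = 0" by (simp add: u x c)
  with K show "w \<in> mat_ker ?K" by (rule psd_isotropic_imp_ker)
qed

theorem theorem4p3:
  fixes A :: "real ^ 'n ^ 'n" and B :: "real ^ 'm ^ 'n"
    and Q :: "real ^ 'n ^ 'n" and S :: "real ^ 'm ^ 'n" and R :: "real ^ 'm ^ 'm"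
    and X1 X2 :: "real ^ 'n ^ 'n"
  assumes "Q = transpose Q" and "R = transpose R"
    and "psd (block_matrix Q S (transpose S) R)"
    and "X1 = transpose X1" and "X2 = transpose X2"
    and "CGDARE_solution A B Q R S X1" and "CGDARE_solution A B Q R S X2"
  shows "mat_ker (R_of B R X1) = mat_ker (R_of B R X2)"
  using mat_ker_R_of_CGDARE_subset[OF assms(2)[symmetric] assms(3)] assms(6,7)
  by (intro equalityI)

end
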